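(* Let $W:\mathbb{R}^2\to\mathbb{R}$ be a measurable function satisfying $W(q,p)\ge 0$ and $\pi W(q,p)\le 1$ for all $(q,p)$, and $\int_{\mathbb{R}^2} W(q,p)\,dq\,dp=1$, and let $\mu:=2\pi\int_{\mathbb{R}^2}W(q,p)^2\,dq\,dp$. If $\mu\le 2/e$, then $$S[W]\ge 1+\ln\pi .$$
   Context: $S[W]:=-\int_{\mathbb{R}^2} W(q,p)\ln W(q,p)\,dq\,dp$ is the Shannon differential entropy of $W$ (the "Wigner entropy"), with the convention $0\ln 0=0$; since $0\le W\le 1/\pi<1$, it is well defined in $[0,+\infty]$. The quantity $\mu$ is called the purity of $W$. Every Wigner function of a single-mode quantum state that is everywhere non-negative satisfies the hypotheses, but $W$ is not required to be the Wigner function of a quantum state. *)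

theory Defs
  imports "HOL-Analysis.Analysis"
begin

text \<open>
  The integral of a real-valued function with values in the extended reals, as the difference
  of the integrals of the positive and the negative part. Unlike the Bochner integral it does
  not collapse to 0 when the function is not integrable. If both parts have infinite integral,
  then the value is the junk value \<open>\<infinity> - \<infinity> = \<infinity>\<close>.
\<close>

definition extended_integral :: "'a measure \<Rightarrow> ('a \<Rightarrow> real) \<Rightarrow> ereal" where
  "extended_integral M f =
     enn2ereal (\<integral>\<^sup>+ x. ennreal (f x) \<partial>M) - enn2ereal (\<integral>\<^sup>+ x. ennreal (- f x) \<partial>M)"

text \<open>The convention \<open>0 ln 0 = 0\<close> holds automatically because of the factor \<open>W z\<close>.\<close>

definition wigner_entropy :: "(real \<times> real \<Rightarrow> real) \<Rightarrow> ereal" where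
  "wigner_entropy W = - extended_integral lebesgue (\<lambda>z. W z * ln (W z))"

definition purity :: "(real \<times> real \<Rightarrow> real) \<Rightarrow> real" where
  "purity W = 2 * pi * (\<integral>z. (W z)\<^sup>2 \<partial>lebesgue)"

text \<open>
  For a function with values in the unit interval the entropy is well defined in
  \<open>[0, \<infinity>]\<close>, and the square of such a function is integrable if the function is.
\<close>

lemma wigner_entropy_eq_nn_integral:
  assumes "\<And>z. 0 \<le> W z" and "\<And>z. W z \<le> 1"
  shows "wigner_entropy W = enn2ereal (\<integral>\<^sup>+ z. ennreal (- (W z * ln (W z))) \<partial>lebesgue)"
proof -
  have "W z * ln (W z) \<le> 0" for z
  proof (cases "W z = 0")
    case False
    with assms[of z] have "ln (W z) \<le> 0" by (simp add: ln_le_zero_iff order_less_le)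
    with assms(1)[of z] show ?thesis by (rule mult_nonneg_nonpos)
  qed simp
  then have "(\<integral>\<^sup>+ z. ennreal (W z * ln (W z)) \<partial>lebesgue) = 0"
    by (simp add: ennreal_neg)
  then show ?thesis
    by (simp add: wigner_entropy_def extended_integral_def zero_ennreal.rep_eq)
qed

lemma integrable_square:
  fixes W :: "real \<times> real \<Rightarrow> real"
  assumes "integrable lebesgue W" and "\<And>z. 0 \<le> W z" and "\<And>z. W z \<le> 1"
  shows "integrable lebesgue (\<lambda>z. (W z)\<^sup>2)"
proof (rule Bochner_Integration.integrable_bound[OF assms(1)])
  show "(\<lambda>z. (W z)\<^sup>2) \<in> borel_measurable lebesgue"
    using borel_measurable_integrable[OF assms(1)] by (rule borel_measurable_power)
  show "AE z in lebesgue. norm ((W z)\<^sup>2) \<le> norm (W z)"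
    using assms(2,3) by (intro AE_I2) (simp add: power2_eq_square mult_left_le)
qed

end

theory Submission
  imports Defs
begin

text \<open>
  Jensen's inequality for the probability density \<open>W\<close> bounds the entropy below by
  \<open>- ln (\<integral> W\<^sup>2)\<close>. Since only the value \<open>1 + ln pi\<close> is needed, it suffices to use the
  tangent of the logarithm at \<open>1 / (e pi)\<close>.
\<close>

lemma neg_mult_ln_ge_tangent:
  fixes w :: real
  assumes "0 \<le> w"
  shows "(2 + ln pi) * w - exp 1 * pi * w\<^sup>2 \<le> - (w * ln w)"
proof (cases "w = 0")
  case False
  with assms have "w > 0" by simp
  \<comment> \<open>The inequality ln x \<le> x - 1 is sharp at x = 1, hence the tangency point w =
    1 / (e pi). Since ln (e pi w) = 1 + ln pi + ln w, the constants add up to 2 + ln pi.\<close>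
  then have "ln (exp 1 * pi * w) \<le> exp 1 * pi * w - 1"
    by (intro ln_le_minus_one) simp
  with \<open>w > 0\<close> have "ln w \<le> exp 1 * pi * w - 2 - ln pi"
    by (simp add: ln_mult)
  then have "w * ln w \<le> w * (exp 1 * pi * w - 2 - ln pi)"
    using assms by (rule mult_left_mono)
  then show ?thesis by (simp add: algebra_simps power2_eq_square)
qed simp

text \<open>The tangent bound takes negative values where \<open>W\<close> is large, whereas
  \<open>ennreal\<close> cuts off at 0; the comparison therefore passes through the positive part of
  \<open>f\<close>. The right-hand side may be infinite, so infinite entropy is covered.\<close>

lemma ereal_integral_le_nn_integral:
  fixes f :: "'a \<Rightarrow> real"
  assumes "integrable M f" and "\<And>x. f x \<le> g x"
  shows "ereal (\<integral>x. f x \<partial>M) \<le> enn2ereal (\<integral>\<^sup>+ x. ennreal (g x) \<partial>M)"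
proof -
  have int: "integrable M (\<lambda>x. max 0 (f x))" using assms(1) by simp
  have "(\<integral>x. f x \<partial>M) \<le> (\<integral>x. max 0 (f x) \<partial>M)"
    by (rule integral_mono[OF assms(1) int]) simp
  then have "ereal (\<integral>x. f x \<partial>M) \<le> ereal (\<integral>x. max 0 (f x) \<partial>M)" by simp
  also have "\<dots> = enn2ereal (ennreal (\<integral>x. max 0 (f x) \<partial>M))"
    by (simp add: enn2ereal_ennreal)
  also have "ennreal (\<integral>x. max 0 (f x) \<partial>M) = (\<integral>\<^sup>+ x. ennreal (max 0 (f x)) \<partial>M)"
    using int by (rule nn_integral_eq_integral[symmetric]) simp
  also have "enn2ereal \<dots> \<le> enn2ereal (\<integral>\<^sup>+ x. ennreal (g x) \<partial>M)"
    unfolding less_eq_ennreal.rep_eq[symmetric]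
  proof (rule nn_integral_mono)
    fix x
    show "ennreal (max 0 (f x)) \<le> ennreal (g x)"
      using assms(2)[of x] by (cases "f x \<le> 0") (auto simp: max_def intro: ennreal_leI)
  qed
  finally show ?thesis .
qed

theorem mainTheorem5:
  fixes W :: "real \<times> real \<Rightarrow> real"
  assumes "W \<in> borel_measurable lebesgue"
    and "\<And>q p. W (q, p) \<ge> 0"
    and "\<And>q p. pi * W (q, p) \<le> 1"
    and "(\<integral>z. W z \<partial>lebesgue) = 1"
    and "purity W \<le> 2 / exp 1"
  shows "wigner_entropy W \<ge> ereal (1 + ln pi)"
proof -
  have nonneg: "0 \<le> W z" for z using assms(2) by (cases z) simp
  have le_1: "W z \<le> 1" for z
  proof -
    have "W z \<le> pi * W z" using nonneg[of z] pi_gt3 mult_right_mono[of 1 pi "W z"] by simp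
    also have "\<dots> \<le> 1" using assms(3) by (cases z) simp
    finally show ?thesis .
  qed
  \<comment> \<open>The Bochner integral of a non-integrable function is 0 by default, so the value
    1 forces integrability.\<close>
  have int: "integrable lebesgue W"
    using assms(4) not_integrable_integral_eq by fastforce
  have int_sq: "integrable lebesgue (\<lambda>z. (W z)\<^sup>2)"
    using int nonneg le_1 by (rule integrable_square)
  let ?f = "\<lambda>z. (2 + ln pi) * W z - exp 1 * pi * (W z)\<^sup>2"
  \<comment> \<open>The purity bound says that the integral of the square is at most 1 / (e pi), the
    tangency point. The quadratic term thus takes at most 1 from 2 + ln pi, which leaves 1 + ln
    pi.\<close>
  have "exp 1 * pi * (\<integral>z. (W z)\<^sup>2 \<partial>lebesgue) \<le> 1"
    using assms(5) by (simp add: purity_def field_simps)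
  then have "1 + ln pi \<le> (\<integral>z. ?f z \<partial>lebesgue)"
    using int int_sq assms(4) by simp
  then have "ereal (1 + ln pi) \<le> ereal (\<integral>z. ?f z \<partial>lebesgue)" by simp
  also have "\<dots> \<le> enn2ereal (\<integral>\<^sup>+ z. ennreal (- (W z * ln (W z))) \<partial>lebesgue)"
    using int int_sq neg_mult_ln_ge_tangent[OF nonneg]
    by (intro ereal_integral_le_nn_integral) auto
  also have "\<dots> = wigner_entropy W"
    using nonneg le_1 by (rule wigner_entropy_eq_nn_integral[symmetric])
  finally show ?thesis .
qed

end
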